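(* Let $\Delta:\mathbb{N}^{(2)}\to\mathbb{N}$ be an infinite colouring and suppose $n\geq 2$ is a natural number. Then there exists an $n$-weakly homogeneous tuple with respect to $\Delta$.
   Context: For a set $X$, $X^{(2)}$ denotes the set of unordered pairs of elements of $X$. A colouring $\Delta:\mathbb{N}^{(2)}\to\mathbb{N}$ is infinite if its image is infinite. For $v\in\mathbb{N}$ and $X\subset\mathbb{N}\setminus\{v\}$, a colour $c$ is a new colour from $v$ into $X$ if some edge from $v$ to a vertex of $X$ has colour $c$ and no edge in $X^{(2)}$ has colour $c$; $N_{\Delta}(v,X)$ denotes the set of such colours. For an $n$-tuple $\mathbf{X}=(X_1,\dots,X_n)$ write $\bar{X}_i=X_1\cup\dots\cup X_i$. The tuple $\mathbf{X}$, with each $X_i$ a nonempty subset of $\mathbb{N}$, is ($n$-)weakly homogeneous with respect to $\Delta$ if: (1) $X_i\cap X_j=\emptyset$ for $i\neq j$; (2) $|X_1|=1$; (3) $\emptyset=\Delta(\bar{X}_1^{(2)})\subsetneq\Delta(\bar{X}_2^{(2)})\subsetneq\dots\subsetneq\Delta(\bar{X}_n^{(2)})$; (4) for each $2\leq i\leq n$ and every $v\in X_i$, $N_{\Delta}(v,\bar{X}_{i-1})=\Delta(\bar{X}_i^{(2)})\setminus\Delta(\bar{X}_{i-1}^{(2)})$; (5) $|\Delta(\bar{X}_n^{(2)})|\leq\binom{n}{2}$. *)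

theory Defs
  imports "HOL-Library.Ramsey"
begin

text \<open>
  The unordered pairs of elements of a set \<open>X\<close> are \<open>nsets X 2\<close>. A colouring is a function
  \<open>\<Delta> :: nat set \<Rightarrow> nat\<close>, of which only the values on \<open>nsets UNIV 2\<close> are meaningful.
\<close>

definition infinite_colouring :: "(nat set \<Rightarrow> nat) \<Rightarrow> bool" where
  "infinite_colouring \<Delta> \<longleftrightarrow> infinite (\<Delta> ` nsets UNIV 2)"

text \<open>Only meaningful for \<open>v \<notin> X\<close>.\<close>

definition new_colours :: "(nat set \<Rightarrow> nat) \<Rightarrow> nat \<Rightarrow> nat set \<Rightarrow> nat set" where
  "new_colours \<Delta> v X = {c. (\<exists>x\<in>X. \<Delta> {v, x} = c) \<and> c \<notin> \<Delta> ` nsets X 2}"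

text \<open>
  An \<open>n\<close>-tuple of sets is a function of which only the values at \<open>1, \<dots>, n\<close> are used.
\<close>

definition initial_union :: "(nat \<Rightarrow> nat set) \<Rightarrow> nat \<Rightarrow> nat set" where
  "initial_union X i = (\<Union>j\<in>{1..i}. X j)"

text \<open>
  In the last clause \<open>finite\<close> is needed because \<open>card\<close> is \<open>0\<close> on infinite sets.
\<close>

definition weakly_homogeneous :: "(nat set \<Rightarrow> nat) \<Rightarrow> nat \<Rightarrow> (nat \<Rightarrow> nat set) \<Rightarrow> bool" where
  "weakly_homogeneous \<Delta> n X \<longleftrightarrow>
     (\<forall>i\<in>{1..n}. X i \<noteq> {}) \<and>
     (\<forall>i\<in>{1..n}. \<forall>j\<in>{1..n}. i \<noteq> j \<longrightarrow> X i \<inter> X j = {}) \<and>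
     card (X 1) = 1 \<and>
     \<Delta> ` nsets (initial_union X 1) 2 = {} \<and>
     (\<forall>i\<in>{1..<n}. \<Delta> ` nsets (initial_union X i) 2 \<subset> \<Delta> ` nsets (initial_union X (Suc i)) 2) \<and>
     (\<forall>i\<in>{2..n}. \<forall>v\<in>X i.
        new_colours \<Delta> v (initial_union X (i - 1)) =
          \<Delta> ` nsets (initial_union X i) 2 - \<Delta> ` nsets (initial_union X (i - 1)) 2) \<and>
     finite (\<Delta> ` nsets (initial_union X n) 2) \<and>
     card (\<Delta> ` nsets (initial_union X n) 2) \<le> n choose 2"

end

theory Submission
  imports Defs
begin

text \<open>
  If some vertex \<open>v\<close> sees infinitely many colours, one can greedily add vertices \<open>x\<^sub>0, x\<^sub>1, \<dots>\<close> to
  \<open>{v}\<close>, each joined to \<open>v\<close> in a colour not used so far. Otherwise there is an infinite matching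
  with edges \<open>a\<^sub>i b\<^sub>i\<close> such that the colour of \<open>a\<^sub>i b\<^sub>i\<close> does not occur at any earlier \<open>a\<^sub>j\<close> or \<open>b\<^sub>j\<close>.
  As every vertex sees finitely many colours, Ramsey's theorem lets us assume that for \<open>i < j\<close> each
  of the colours of \<open>a\<^sub>i a\<^sub>j\<close>, \<open>a\<^sub>i b\<^sub>j\<close>, \<open>b\<^sub>i a\<^sub>j\<close>, \<open>b\<^sub>i b\<^sub>j\<close> depends on \<open>i\<close> only, and either injectively
  or not at all. If one of the four dependencies is injective, a vertex of large index can play the
  role of \<open>v\<close> above. If all four are constant, take \<open>{a\<^sub>1}, {a\<^sub>2, \<dots>}, {b\<^sub>1}, {b\<^sub>2}, \<dots>\<close>: only
  \<open>4 + (n - 2)\<close> colours occur, which is at most \<open>n choose 2\<close> for \<open>n \<ge> 4\<close>; for \<open>n \<le> 3\<close> the vertices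
  \<open>a\<^sub>1, a\<^sub>2, b\<^sub>1\<close> suffice.
\<close>

section \<open>Colours of pairs, new colours and initial unions\<close>

lemma colours_iff:
  "c \<in> \<Delta> ` nsets X 2 \<longleftrightarrow> (\<exists>x\<in>X. \<exists>y\<in>X. x \<noteq> y \<and> c = \<Delta> {x, y})"
  by (fastforce simp: nsets_2_eq)

lemma colours_mono: "X \<subseteq> Y \<Longrightarrow> \<Delta> ` nsets X 2 \<subseteq> \<Delta> ` nsets Y 2"
  by (intro image_mono nsets_mono)

lemma finite_colours: "finite X \<Longrightarrow> finite (\<Delta> ` nsets X 2)"
  by (simp add: finite_imp_finite_nsets)

lemma card_colours_le:
  assumes "finite X"
  shows "card (\<Delta> ` nsets X 2) \<le> card X choose 2"
proof -
  have "card (\<Delta> ` nsets X 2) \<le> card (nsets X 2)"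
    using assms by (intro card_image_le finite_imp_finite_nsets)
  then show ?thesis by simp
qed

text \<open>The pairs of \<open>insert v Y\<close> outside \<open>Y\<close> are exactly the edges
  from \<open>v\<close> into \<open>Y\<close>. Hence the condition on new colours is automatic for a
  layer with a single vertex.\<close>

lemma new_colours_insert:
  assumes "v \<notin> Y"
  shows "new_colours \<Delta> v Y = \<Delta> ` nsets (insert v Y) 2 - \<Delta> ` nsets Y 2"
proof -
  have "nsets (insert v Y) 2 = nsets Y 2 \<union> (\<lambda>x. {v, x}) ` Y"
    using assms by (fastforce simp: nsets_2_eq)
  then show ?thesis by (auto simp: new_colours_def)
qed

lemma initial_union_one: "initial_union X 1 = X 1"
  by (simp add: initial_union_def)

lemma initial_union_Suc: "initial_union X (Suc i) = initial_union X i \<union> X (Suc i)"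
  by (auto simp: initial_union_def atLeastAtMostSuc_conv)

section \<open>Sufficient conditions for weak homogeneity\<close>

text \<open>Only the second layer \<open>B\<close> may have several vertices; as
  \<open>insert u B\<close> is monochromatic, all of them see the same single new colour. Later
  layers are singletons, which leaves freshness, one new colour for each, and the final
  count.\<close>

lemma weakly_homogeneousI:
  fixes \<Delta> :: "nat set \<Rightarrow> nat"
  defines "S \<equiv> \<lambda>u B v m. insert u B \<union> v ` {..<m::nat}"
  assumes n: "n \<ge> 2" and B: "u \<notin> B" "B \<noteq> {}"
    and mono: "\<And>x y. x \<in> insert u B \<Longrightarrow> y \<in> insert u B \<Longrightarrow> x \<noteq> y \<Longrightarrow> \<Delta> {x, y} = c"
    and fresh: "\<And>i. i < n - 2 \<Longrightarrow> v i \<notin> S u B v i"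
    and new: "\<And>i. i < n - 2 \<Longrightarrow> new_colours \<Delta> (v i) (S u B v i) \<noteq> {}"
    and fin: "finite (\<Delta> ` nsets (S u B v (n - 2)) 2)"
    and card: "card (\<Delta> ` nsets (S u B v (n - 2)) 2) \<le> n choose 2"
  shows "\<exists>X. weakly_homogeneous \<Delta> n X"
proof -
  \<comment> \<open>Tuples start at index \<open>1\<close> and layers \<open>1\<close> and
    \<open>2\<close> are taken, so the sequence \<open>v\<close> enters at index
    \<open>3\<close>.\<close>
  define X where "X i = (if i = 1 then {u} else if i = 2 then B else {v (i - 3)})" for i :: nat
  have X1: "initial_union X (Suc 0) = {u}"
    using initial_union_one[of X] by (simp add: X_def)
  have S_eq: "initial_union X (Suc (Suc m)) = S u B v m" for m
  proof (induction m)
    case 0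
    show ?case by (simp add: initial_union_Suc[of X "Suc 0"] X1 S_def) (simp add: X_def)
  next
    case (Suc m)
    have "X (Suc (Suc (Suc m))) = {v m}" by (simp add: X_def)
    then show ?case
      using Suc initial_union_Suc[of X "Suc (Suc m)"] by (auto simp: S_def lessThan_Suc)
  qed
  have S_Suc: "S u B v (Suc m) = insert (v m) (S u B v m)" for m
    by (auto simp: S_def lessThan_Suc)
  have disj: "X (Suc i) \<inter> initial_union X i = {}" if "i \<ge> 1" "Suc i \<le> n" for i
  proof (cases "i = 1")
    case True
    then have "X (Suc i) = B" by (simp add: X_def)
    then show ?thesis using B True by (simp add: X1)
  next
    case False
    define k where "k = i - 2"
    have k: "i = Suc (Suc k)" using that False by (simp add: k_def)
    then have "X (Suc i) = {v k}" by (simp add: X_def)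
    then show ?thesis using fresh[of k] that by (simp add: k S_eq)
  qed
  have disj': "X i \<inter> X j = {}" if "1 \<le> i" "i < j" "j \<le> n" for i j
  proof -
    have "X i \<subseteq> initial_union X (j - 1)"
      unfolding initial_union_def using that by (intro UN_upper) simp
    moreover have "X j \<inter> initial_union X (j - 1) = {}"
      using disj[of "j - 1"] that by simp
    ultimately show ?thesis by blast
  qed
  have single: "\<Delta> ` nsets {u} 2 = {}"
    by (simp add: nsets_2_eq)
  obtain b where b: "b \<in> B" using B by blast
  have mono': "\<Delta> ` nsets (S u B v 0) 2 = {c}"
  proof (intro equalityI subsetI)
    show "x \<in> {c}" if "x \<in> \<Delta> ` nsets (S u B v 0) 2" for x
      using that mono unfolding colours_iff by (auto simp: S_def)
    have "{u, b} \<in> nsets (S u B v 0) 2" "\<Delta> {u, b} = c"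
      using b B mono[of u b] by (auto simp: S_def)
    then show "x \<in> \<Delta> ` nsets (S u B v 0) 2" if "x \<in> {c}" for x
      using that by blast
  qed
  have new2: "new_colours \<Delta> x {u} = {c}" if "x \<in> B" for x
    using that B mono[of x u] by (cases "x = u") (auto simp: new_colours_def single)
  have new_eq: "new_colours \<Delta> (v k) (S u B v k)
      = \<Delta> ` nsets (S u B v (Suc k)) 2 - \<Delta> ` nsets (S u B v k) 2" if "k < n - 2" for k
    using new_colours_insert[OF fresh[OF that]] by (simp add: S_Suc)
  have sub: "\<Delta> ` nsets (initial_union X i) 2 \<subset> \<Delta> ` nsets (initial_union X (Suc i)) 2"
    if "i \<in> {1..<n}" for i
  proof (cases "i = 1")
    case True
    then show ?thesis using mono' by (simp add: X1 S_eq single psubset_eq)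
  next
    case False
    define k where "k = i - 2"
    have k: "i = Suc (Suc k)" using that False by (auto simp: k_def)
    then have "k < n - 2" using that by auto
    then have "\<Delta> ` nsets (S u B v (Suc k)) 2 - \<Delta> ` nsets (S u B v k) 2 \<noteq> {}"
      using new[of k] new_eq[of k] by simp
    moreover have "\<Delta> ` nsets (S u B v k) 2 \<subseteq> \<Delta> ` nsets (S u B v (Suc k)) 2"
      by (intro colours_mono) (auto simp: S_Suc)
    ultimately show ?thesis unfolding k S_eq by blast
  qed
  have four: "new_colours \<Delta> x (initial_union X (i - 1))
      = \<Delta> ` nsets (initial_union X i) 2 - \<Delta> ` nsets (initial_union X (i - 1)) 2"
    if "i \<in> {2..n}" "x \<in> X i" for i x
  proof (cases "i = 2")
    case True
    then have "x \<in> B" using that by (simp add: X_def)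
    have iu: "initial_union X i = S u B v 0" "initial_union X (i - 1) = {u}"
      using True S_eq[of 0] X1 by (simp_all add: numeral_2_eq_2)
    show ?thesis
      unfolding iu mono' single new2[OF \<open>x \<in> B\<close>] by simp
  next
    case False
    define k where "k = i - 3"
    have k: "i = Suc (Suc (Suc k))" using that False by (auto simp: k_def)
    have "x = v k" "k < n - 2" using that k by (auto simp: X_def)
    then show ?thesis using new_eq by (simp add: k S_eq)
  qed
  have "Suc (Suc (n - 2)) = n" using n by simp
  with S_eq[of "n - 2"] have last: "initial_union X n = S u B v (n - 2)" by simp
  have "weakly_homogeneous \<Delta> n X"
    unfolding weakly_homogeneous_def
  proof (intro conjI ballI impI)
    show "X i \<noteq> {}" for i using B by (simp add: X_def)
    show "X i \<inter> X j = {}" if "i \<in> {1..n}" "j \<in> {1..n}" "i \<noteq> j" for i j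
      using that disj'[of i j] disj'[of j i] by (cases "i < j") auto
    show "card (X 1) = 1" by (simp add: X_def)
    show "\<Delta> ` nsets (initial_union X 1) 2 = {}" by (simp add: X1 single)
  qed (use sub four fin card last in auto)
  then show ?thesis by blast
qed

text \<open>All layers are single vertices, so at most \<open>n\<close> vertices occur and the bound
  on colours is just the number of pairs.\<close>

lemma weakly_homogeneous_chain:
  fixes \<Delta> :: "nat set \<Rightarrow> nat"
  assumes n: "n \<ge> 2"
    and fresh: "\<And>i. 0 < i \<Longrightarrow> i < n \<Longrightarrow> w i \<notin> w ` {..<i}"
    and new: "\<And>i. 2 \<le> i \<Longrightarrow> i < n \<Longrightarrow> \<exists>j<i. \<Delta> {w i, w j} \<notin> \<Delta> ` nsets (w ` {..<i}) 2"
  shows "\<exists>X. weakly_homogeneous \<Delta> n X"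
proof -
  have S: "insert (w 0) {w 1} \<union> (\<lambda>i. w (i + 2)) ` {..<m} = w ` {..<m + 2}" for m
    by (induction m) (auto simp: lessThan_Suc)
  have fin: "finite (w ` {..<n})" by simp
  have "card (w ` {..<n}) \<le> n" using card_image_le[of "{..<n}" w] by simp
  then have "card (w ` {..<n}) choose 2 \<le> n choose 2"
    by (rule binomial_right_mono)
  with card_colours_le[OF fin, of \<Delta>]
  have card: "card (\<Delta> ` nsets (w ` {..<n}) 2) \<le> n choose 2"
    by (rule le_trans)
  have n2: "n - 2 + 2 = n" using n by simp
  show ?thesis
  proof (rule weakly_homogeneousI[of n "w 0" "{w 1}" \<Delta> "\<Delta> {w 0, w 1}" "\<lambda>i. w (i + 2)"],
      unfold S n2)
    show "w 0 \<notin> {w 1}" using fresh[of 1] n by auto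
    show "\<Delta> {x, y} = \<Delta> {w 0, w 1}"
      if "x \<in> insert (w 0) {w 1}" "y \<in> insert (w 0) {w 1}" "x \<noteq> y" for x y
      using that by (auto simp: insert_commute)
    show "w (i + 2) \<notin> w ` {..<i + 2}" if "i < n - 2" for i
      using that by (intro fresh) auto
    show "new_colours \<Delta> (w (i + 2)) (w ` {..<i + 2}) \<noteq> {}" if "i < n - 2" for i
    proof -
      from that have "i + 2 < n" by simp
      with new[of "i + 2"] obtain j where
        "j < i + 2" "\<Delta> {w (i + 2), w j} \<notin> \<Delta> ` nsets (w ` {..<i + 2}) 2" by auto
      then show ?thesis unfolding new_colours_def by blast
    qed
  qed (use n card finite_colours[OF fin] in simp_all)
qed

text \<open>Vertices are added in the order \<open>y\<close>, \<open>x 0\<close>,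
  \<open>x 1\<close>, and so on. The spoke from \<open>x i\<close> to the hub \<open>y\<close>
  differs in colour from earlier spokes by \<open>new1\<close> and from edges among earlier
  \<open>x j\<close> by \<open>new2\<close>.\<close>

lemma weakly_homogeneous_hub:
  fixes \<Delta> :: "nat set \<Rightarrow> nat"
  assumes n: "n \<ge> 2" and y: "\<And>i. i < n \<Longrightarrow> x i \<noteq> y"
    and new1: "\<And>i j. j < i \<Longrightarrow> i < n \<Longrightarrow> \<Delta> {x i, y} \<noteq> \<Delta> {x j, y}"
    and new2: "\<And>i j k. j < k \<Longrightarrow> k < i \<Longrightarrow> i < n \<Longrightarrow> \<Delta> {x i, y} \<noteq> \<Delta> {x j, x k}"
  shows "\<exists>X. weakly_homogeneous \<Delta> n X"
proof -
  define w where "w i = (case i of 0 \<Rightarrow> y | Suc i \<Rightarrow> x i)" for i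
  have w_image: "w ` {..<Suc k} = insert y (x ` {..<k})" for k
    by (auto simp: w_def lessThan_Suc_eq_insert_0 image_image)
  have new2': "\<Delta> {x i, y} \<noteq> \<Delta> {x j, x k}" if "j \<noteq> k" "j < i" "k < i" "i < n" for i j k
    using that new2[of j k i] new2[of k j i] by (cases "j < k") (auto simp: insert_commute)
  show ?thesis
  proof (rule weakly_homogeneous_chain[OF n])
    fix i assume i: "0 < i" "i < n"
    then obtain k where k: "i = Suc k" using gr0_implies_Suc by blast
    have "x k \<noteq> x j" if "j < k" for j
      using new1[OF that] i k by fastforce
    then show "w i \<notin> w ` {..<i}"
      unfolding k w_image using y[of k] i k by (auto simp: w_def)
  next
    fix i assume i: "2 \<le> i" "i < n"
    define k where "k = i - 1"
    have k: "i = Suc k" "k < n" using i by (auto simp: k_def)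
    have "\<Delta> {x k, y} \<notin> \<Delta> ` nsets (insert y (x ` {..<k})) 2"
    proof
      assume "\<Delta> {x k, y} \<in> \<Delta> ` nsets (insert y (x ` {..<k})) 2"
      then obtain p q where pq: "p \<in> insert y (x ` {..<k})" "q \<in> insert y (x ` {..<k})" "p \<noteq> q"
        "\<Delta> {x k, y} = \<Delta> {p, q}"
        unfolding colours_iff by blast
      then consider (spoke) j where "j < k" "{p, q} = {x j, y}"
        | (rim) j j' where "j < k" "j' < k" "j \<noteq> j'" "{p, q} = {x j, x j'}"
        by blast
      then show False
        using pq(4) new1[of _ k] new2'[of _ _ k] k(2) by cases auto
    qed
    then have "\<Delta> {w i, w 0} \<notin> \<Delta> ` nsets (w ` {..<i}) 2"
      unfolding k(1) w_image by (simp add: w_def)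
    then show "\<exists>j<i. \<Delta> {w i, w j} \<notin> \<Delta> ` nsets (w ` {..<i}) 2"
      using i by (intro exI[of _ 0]) auto
  qed
qed

section \<open>A vertex that sees infinitely many colours\<close>

lemma weakly_homogeneous_infinite_degree:
  fixes \<Delta> :: "nat set \<Rightarrow> nat"
  assumes n: "n \<ge> 2" and inf: "infinite (range (\<lambda>y. \<Delta> {v, y}))"
  shows "\<exists>X. weakly_homogeneous \<Delta> n X"
proof -
  \<comment> \<open>Only values of \<open>x\<close> below \<open>i\<close> enter, as the recursive
    choice requires. The diagonal \<open>j = k\<close> adds values of \<open>\<Delta>\<close> at
    singletons, which merely forbids finitely many more colours.\<close>
  define used where "used x i = (\<lambda>j. \<Delta> {x j, v}) ` {..<i} \<union> (\<lambda>(j, k). \<Delta> {x j, x k}) ` ({..<i} \<times> {..<i})"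
    for x :: "nat \<Rightarrow> nat" and i :: nat
  define P where "P x i r \<longleftrightarrow> r \<noteq> v \<and> \<Delta> {r, v} \<notin> used x i" for x i r
  have "\<exists>x. \<forall>i. P x i (x i)"
  proof (rule dependent_wellorder_choice)
    show "P f i r = P g i r" if "\<And>j. j < i \<Longrightarrow> f j = g j" for r f g i
    proof -
      have "used f i = used g i"
        unfolding used_def using that by (intro arg_cong2[of _ _ _ _ "(\<union>)"] image_cong) auto
      then show ?thesis by (simp add: P_def)
    qed
    show "\<exists>r. P x i r" for i x
    proof -
      \<comment> \<open>Forbidding also \<open>\<Delta> {v, v}\<close>, the value for
        \<open>r = v\<close>, forces \<open>r \<noteq> v\<close>.\<close>
      have "finite (insert (\<Delta> {v, v}) (used x i))" by (simp add: used_def)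
      with inf have "\<not> range (\<lambda>y. \<Delta> {v, y}) \<subseteq> insert (\<Delta> {v, v}) (used x i)"
        using finite_subset by blast
      then obtain r where "\<Delta> {v, r} \<notin> insert (\<Delta> {v, v}) (used x i)" by blast
      then have "P x i r" by (auto simp: P_def insert_commute)
      then show ?thesis by blast
    qed
  qed
  then obtain x where x: "\<And>i. x i \<noteq> v" "\<And>i. \<Delta> {x i, v} \<notin> used x i"
    unfolding P_def by blast
  show ?thesis
  proof (rule weakly_homogeneous_hub[OF n])
    show "x i \<noteq> v" for i by (rule x)
    show "\<Delta> {x i, v} \<noteq> \<Delta> {x j, v}" if "j < i" for i j
      using x(2)[of i] that by (auto simp: used_def)
    show "\<Delta> {x i, v} \<noteq> \<Delta> {x j, x k}" if "j < k" "k < i" for i j k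
      using x(2)[of i] that by (force simp: used_def)
  qed
qed

section \<open>A rainbow matching under finite colour degrees\<close>

text \<open>The finitely many earlier endpoints see finitely many colours in total, so some edge has
  a colour outside all of these. As \<open>y\<close> is arbitrary, that edge also avoids the earlier
  endpoints. The \<open>bool\<close> argument names the two ends of an edge.\<close>

lemma rainbow_matching:
  fixes \<Delta> :: "nat set \<Rightarrow> nat"
  assumes inf: "infinite_colouring \<Delta>" and deg: "\<And>v. finite (range (\<lambda>y. \<Delta> {v, y}))"
  obtains V :: "bool \<Rightarrow> nat \<Rightarrow> nat"
  where "\<And>i. V True i \<noteq> V False i"
    and "\<And>s i j y. j < i \<Longrightarrow> \<Delta> {V True i, V False i} \<noteq> \<Delta> {V s j, y}"
proof -
  define P where "P f i r \<longleftrightarrow> r True \<noteq> r False \<and>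
      (\<forall>s. \<forall>j<i. \<forall>y. \<Delta> {r True, r False} \<noteq> \<Delta> {f j s, y})"
    for f :: "nat \<Rightarrow> bool \<Rightarrow> nat" and i :: nat and r
  have "\<exists>f. \<forall>i. P f i (f i)"
  proof (rule dependent_wellorder_choice)
    show "P f i r = P g i r" if "\<And>j. j < i \<Longrightarrow> f j = g j" for r f g i
      using that by (simp add: P_def)
    show "\<exists>r. P f i r" for i f
    proof -
      let ?U = "\<Union>s. \<Union>j<i. range (\<lambda>y. \<Delta> {f j s, y})"
      have "finite ?U" using deg by simp
      with inf have "\<not> \<Delta> ` nsets UNIV 2 \<subseteq> ?U"
        unfolding infinite_colouring_def using finite_subset by blast
      then obtain c where c: "c \<in> \<Delta> ` nsets UNIV 2" "c \<notin> ?U" by blast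
      then obtain p q where "p \<noteq> q" "c = \<Delta> {p, q}" unfolding colours_iff by blast
      with c(2) have "P f i (\<lambda>s. if s then p else q)" by (auto simp: P_def)
      then show ?thesis by blast
    qed
  qed
  then obtain f where f: "\<And>i. P f i (f i)" by blast
  show thesis
    by (rule that[of "\<lambda>s i. f i s"]) (use f in \<open>auto simp: P_def\<close>)
qed

section \<open>Colourings governed by the smaller index\<close>

text \<open>Ramsey's theorem colours sets while \<open>Q\<close> speaks of ordered triples; a set of
  three numbers has only one increasing enumeration, so the two views agree.\<close>

lemma ramsey_triples:
  fixes Q :: "nat \<Rightarrow> nat \<Rightarrow> nat \<Rightarrow> bool"
  assumes "infinite Z"
  obtains H where "H \<subseteq> Z" "infinite H"
    "(\<forall>i\<in>H. \<forall>j\<in>H. \<forall>k\<in>H. i < j \<longrightarrow> j < k \<longrightarrow> Q i j k) \<or>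
     (\<forall>i\<in>H. \<forall>j\<in>H. \<forall>k\<in>H. i < j \<longrightarrow> j < k \<longrightarrow> \<not> Q i j k)"
proof -
  define f :: "nat set \<Rightarrow> nat"
    where "f X = (if \<forall>i\<in>X. \<forall>j\<in>X. \<forall>k\<in>X. i < j \<longrightarrow> j < k \<longrightarrow> Q i j k then 0 else 1)" for X
  have "\<forall>X. X \<subseteq> Z \<and> finite X \<and> card X = 3 \<longrightarrow> f X < 2"
    by (simp add: f_def)
  from Ramsey[OF assms this] obtain H t where H: "H \<subseteq> Z" "infinite H"
    and t: "\<forall>X. X \<subseteq> H \<and> finite X \<and> card X = 3 \<longrightarrow> f X = t"
    by (elim exE conjE)
  have eq: "f {i, j, k} = (if Q i j k then 0 else 1)" if "i < j" "j < k" for i j k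
    using that by (auto simp: f_def)
  have "f {i, j, k} = t" if "i \<in> H" "j \<in> H" "k \<in> H" "i < j" "j < k" for i j k
    using that by (intro t[rule_format]) auto
  with eq have "Q i j k \<longleftrightarrow> t = 0"
    if "i \<in> H" "j \<in> H" "k \<in> H" "i < j" "j < k" for i j k
    using that by (metis zero_neq_one)
  then show thesis using that[OF H] by blast
qed

text \<open>Two of the four patterns of the canonical Ramsey theorem of Erdos and Rado. In the other
  two each \<open>C i\<close> takes infinitely many values.\<close>

definition canonical_on :: "nat set \<Rightarrow> (nat \<Rightarrow> nat \<Rightarrow> 'a) \<Rightarrow> (nat \<Rightarrow> 'a) \<Rightarrow> bool" where
  "canonical_on H C f \<longleftrightarrow> (\<forall>i\<in>H. \<forall>j\<in>H. i < j \<longrightarrow> C i j = f i) \<and>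
     (inj_on f H \<or> (\<exists>c. \<forall>i\<in>H. f i = c))"

lemma canonical_on_subset: "canonical_on H C f \<Longrightarrow> H' \<subseteq> H \<Longrightarrow> canonical_on H' C f"
  unfolding canonical_on_def by (meson inj_on_subset subsetD)

lemma ex_canonical:
  fixes C :: "nat \<Rightarrow> nat \<Rightarrow> 'a"
  assumes Z: "infinite Z" and fin: "\<And>i. finite (range (C i))"
  obtains H f where "H \<subseteq> Z" "infinite H" "canonical_on H C f"
proof -
  obtain H where H: "H \<subseteq> Z" "infinite H"
    and alt: "(\<forall>i\<in>H. \<forall>j\<in>H. \<forall>k\<in>H. i < j \<longrightarrow> j < k \<longrightarrow> C i j = C i k) \<or>
     (\<forall>i\<in>H. \<forall>j\<in>H. \<forall>k\<in>H. i < j \<longrightarrow> j < k \<longrightarrow> C i j \<noteq> C i k)"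
    using ramsey_triples[OF Z, of "\<lambda>i j k. C i j = C i k"] by blast
  obtain i where "i \<in> H" using H(2) by fastforce
  \<comment> \<open>There are infinitely many \<open>j\<close> above \<open>i\<close> but finitely
    many values of \<open>C i\<close>, so two coincide; this rules out the second alternative of
    \<open>alt\<close>.\<close>
  have "infinite (H - {..i})" using H(2) by simp
  moreover have "finite (C i ` (H - {..i}))"
    using fin[of i] by (rule finite_subset[rotated]) auto
  ultimately have "\<not> inj_on (C i) (H - {..i})" using finite_imageD by blast
  then have "\<exists>j\<in>H. \<exists>k\<in>H. i < j \<and> j < k \<and> C i j = C i k"
    by (auto simp: inj_on_def) (metis linorder_neqE_nat not_le)
  with alt \<open>i \<in> H\<close> have eq: "C i j = C i k"
    if "i \<in> H" "j \<in> H" "k \<in> H" "i < j" "j < k" for i j k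
    using that by blast
  define f where "f i = C i (SOME j. j \<in> H \<and> i < j)" for i
  have f: "C i j = f i" if "i \<in> H" "j \<in> H" "i < j" for i j
  proof -
    define l where "l = (SOME l. l \<in> H \<and> i < l)"
    have "l \<in> H \<and> i < l"
      unfolding l_def using that by (intro someI[of "\<lambda>l. l \<in> H \<and> i < l" j]) auto
    then have "C i j = C i l"
      using that eq[of i j l] eq[OF \<open>i \<in> H\<close> _ \<open>j \<in> H\<close>, of l, symmetric]
      by (cases j l rule: linorder_cases) blast+
    then show ?thesis by (simp add: f_def l_def)
  qed
  \<comment> \<open>If \<open>f\<close> has finite image on \<open>H\<close>, an infinite fibre
    makes it constant; otherwise a set of representatives makes it injective.\<close>
  have "\<exists>H'\<subseteq>H. infinite H' \<and> (inj_on f H' \<or> (\<exists>c. \<forall>i\<in>H'. f i = c))"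
  proof (cases "finite (f ` H)")
    case True
    obtain a where a: "infinite {i \<in> H. f i = f a}"
      using pigeonhole_infinite[OF H(2) True] by (elim bexE)
    have "\<forall>i \<in> {i \<in> H. f i = f a}. f i = f a" "{i \<in> H. f i = f a} \<subseteq> H" by auto
    with a show ?thesis by blast
  next
    case False
    obtain U where "U \<subseteq> H" "inj_on f U" "f ` H = f ` U"
      using subset_image_inj[of "f ` H" f H] by auto
    with False have "infinite U" by auto
    with \<open>U \<subseteq> H\<close> \<open>inj_on f U\<close> show ?thesis by blast
  qed
  then obtain H' where "H' \<subseteq> H" "infinite H'" "inj_on f H' \<or> (\<exists>c. \<forall>i\<in>H'. f i = c)"
    by blast
  then show thesis using that[of H' f] H f by (auto simp: canonical_on_def subset_iff)
qed

text \<open>The set is thinned for one index of \<open>K\<close> at a time; canonicity already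
  achieved passes to subsets.\<close>

lemma ex_canonical_family:
  fixes C :: "'k \<Rightarrow> nat \<Rightarrow> nat \<Rightarrow> 'a"
  assumes "finite K" and fin: "\<And>k i. finite (range (C k i))"
  shows "\<exists>H f. infinite H \<and> (\<forall>k\<in>K. canonical_on H (C k) (f k))"
  using \<open>finite K\<close>
proof induction
  case empty
  show ?case by (intro exI[of _ UNIV]) simp
next
  case (insert k K)
  then obtain H f where H: "infinite H" "\<And>l. l \<in> K \<Longrightarrow> canonical_on H (C l) (f l)" by blast
  obtain H' g where H': "H' \<subseteq> H" "infinite H'" "canonical_on H' (C k) g"
    by (rule ex_canonical[where C = "C k", OF H(1) fin])
  have "canonical_on H' (C l) ((f(k := g)) l)" if "l \<in> insert k K" for l
    using that H'(3) canonical_on_subset[OF H(2) H'(1)] by (cases "l = k") auto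
  with H'(2) show ?case by (intro exI[of _ H'] exI[of _ "f(k := g)"]) blast
qed

section \<open>A matching with constant cross colours\<close>

lemma weakly_homogeneous_constant_matching:
  fixes \<Delta> :: "nat set \<Rightarrow> nat" and V :: "bool \<Rightarrow> nat \<Rightarrow> nat"
  assumes n: "n \<ge> 2" and V: "\<And>s t i j. V s i = V t j \<longleftrightarrow> s = t \<and> i = j"
    and match: "\<And>s i j y. j < i \<Longrightarrow> \<Delta> {V True i, V False i} \<noteq> \<Delta> {V s j, y}"
    and const: "\<And>s t i j. i < j \<Longrightarrow> \<Delta> {V s i, V t j} = c (s, t)"
  shows "\<exists>X. weakly_homogeneous \<Delta> n X"
proof -
  \<comment> \<open>The matching edge at index \<open>0\<close> is skipped because its colour may lie in the range of \<open>c\<close>.\<close>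
  define W where "W s i = V s (Suc i)" for s i
  define d where "d i = \<Delta> {W True i, W False i}" for i
  \<comment> \<open>The range \<open>{1..n}\<close> is finite, yet large enough for
    \<open>S i\<close> to contain the partner \<open>W True i\<close> of each added vertex
    \<open>W False i\<close>.\<close>
  define S where "S m = insert (W True 0) (W True ` {1..n}) \<union> W False ` {..<m}" for m
  have W: "W s i = W t j \<longleftrightarrow> s = t \<and> i = j" for s t i j
    using V by (simp add: W_def)
  \<comment> \<open>Every \<open>c k\<close> is the colour of an edge from index \<open>0\<close> to
    index \<open>1\<close>, and \<open>match\<close> keeps later matching colours away from all
    edges at index \<open>0\<close>.\<close>
  have d_c: "d i \<noteq> c k" for i k
    using match[of 0 "Suc i" "fst k" "V (snd k) 1"] const[of 0 1 "fst k" "snd k"]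
    by (simp add: d_def W_def)
  have d_d: "d i \<noteq> d j" if "j < i" for i j
    using match[of "Suc j" "Suc i" True] that by (simp add: d_def W_def)
  have edge: "\<Delta> {W s i, W t j} \<in> range c" if "i \<noteq> j" for s t i j
  proof (cases "i < j")
    case True
    then show ?thesis using const[of "Suc i" "Suc j" s t] by (simp add: W_def)
  next
    case False
    then show ?thesis using that const[of "Suc j" "Suc i" t s]
      by (simp add: W_def insert_commute)
  qed
  have S_cases: "\<exists>s i. x = W s i \<and> (\<not> s \<longrightarrow> i < m)" if "x \<in> S m" for x m
    using that by (auto simp: S_def)
  have colours: "\<Delta> ` nsets (S m) 2 \<subseteq> range c \<union> d ` {..<m}" for m
  proof
    fix e assume "e \<in> \<Delta> ` nsets (S m) 2"
    then obtain x y where xy: "x \<in> S m" "y \<in> S m" "x \<noteq> y" "e = \<Delta> {x, y}"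
      unfolding colours_iff by blast
    from S_cases[OF xy(1)] obtain s i where x: "x = W s i" "\<not> s \<longrightarrow> i < m" by blast
    from S_cases[OF xy(2)] obtain t j where y: "y = W t j" "\<not> t \<longrightarrow> j < m" by blast
    show "e \<in> range c \<union> d ` {..<m}"
    proof (cases "i = j")
      \<comment> \<open>Distinct vertices of equal index are the two ends of a matching edge, and
        the \<open>False\<close> end bounds the index by \<open>m\<close>.\<close>
      case True
      with x y xy have "e = d i" "i < m"
        by (cases s; cases t; simp add: d_def insert_commute)+
      then show ?thesis by simp
    next
      case False
      with x y xy edge show ?thesis by simp
    qed
  qed
  have d_new: "d m \<notin> \<Delta> ` nsets (S m) 2" for m
    using colours[of m] d_c[of m] d_d[of _ m] by blast
  show ?thesis
  proof (cases "n \<le> 3")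
    case True
    \<comment> \<open>The third vertex is the partner of \<open>w 0\<close>, so it brings the
      matching colour \<open>d 0\<close>.\<close>
    define w where "w i = (if i = 2 then W False 0 else W True i)" for i
    show ?thesis
    proof (rule weakly_homogeneous_chain[OF n])
      show "w i \<notin> w ` {..<i}" for i by (auto simp: w_def W)
      fix i assume "2 \<le> i" "i < n"
      with True have i: "i = 2" by simp
      have "w ` {..<2} \<subseteq> S 0"
        using n by (auto simp: w_def S_def dest!: less_2_cases)
      then have "\<Delta> ` nsets (w ` {..<2}) 2 \<subseteq> \<Delta> ` nsets (S 0) 2" by (rule colours_mono)
      moreover have "\<Delta> {w 2, w 0} = d 0" by (simp add: w_def d_def insert_commute)
      ultimately show "\<exists>j<i. \<Delta> {w i, w j} \<notin> \<Delta> ` nsets (w ` {..<i}) 2"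
        using d_new[of 0] i by (intro exI[of _ 0]) auto
    qed
  next
    case False
    have finS: "finite (S m)" for m by (simp add: S_def)
    show ?thesis
    proof (rule weakly_homogeneousI[of n "W True 0" "W True ` {1..n}" \<Delta> "c (True, True)" "W False"],
        fold S_def)
      show "W True 0 \<notin> W True ` {1..n}" by (auto simp: W)
      show "W True ` {1..n} \<noteq> {}" using n by simp
      show "\<Delta> {x, y} = c (True, True)" if "x \<in> insert (W True 0) (W True ` {1..n})"
        "y \<in> insert (W True 0) (W True ` {1..n})" "x \<noteq> y" for x y
      proof -
        from that obtain i j where ij: "x = W True i" "y = W True j" by blast
        with \<open>x \<noteq> y\<close> have "i \<noteq> j" by auto
        then have "i < j \<or> j < i" by arith
        with ij show ?thesis using const[of "Suc i" "Suc j" True True] const[of "Suc j" "Suc i" True True]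
          by (auto simp: W_def insert_commute)
      qed
      show "W False i \<notin> S i" for i by (auto simp: S_def W)
      show "new_colours \<Delta> (W False i) (S i) \<noteq> {}" if "i < n - 2" for i
      proof -
        have "W True i \<in> S i" using that by (cases i) (auto simp: S_def)
        moreover have "\<Delta> {W False i, W True i} = d i" by (simp add: d_def insert_commute)
        ultimately have "d i \<in> new_colours \<Delta> (W False i) (S i)"
          using d_new[of i] by (auto simp: new_colours_def)
        then show ?thesis by blast
      qed
      show "finite (\<Delta> ` nsets (S (n - 2)) 2)" by (rule finite_colours[OF finS])
      have "card (\<Delta> ` nsets (S (n - 2)) 2) \<le> card (range c \<union> d ` {..<n - 2})"
        by (intro card_mono colours) simp
      also have "\<dots> \<le> card (range c) + card (d ` {..<n - 2})"
        by (rule card_Un_le)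
      also have "\<dots> \<le> 4 + (n - 2)"
      proof (rule add_mono)
        have "card (UNIV :: (bool \<times> bool) set) = 4"
          unfolding UNIV_Times_UNIV[symmetric] card_cartesian_product card_UNIV_bool by simp
        then show "card (range c) \<le> 4" using card_image_le[of UNIV c] by simp
        show "card (d ` {..<n - 2}) \<le> n - 2" using card_image_le[of "{..<n - 2}" d] by simp
      qed
      also have "\<dots> \<le> n choose 2"
      proof -
        \<comment> \<open>Equality holds at \<open>n = 4\<close>, and at \<open>n = 3\<close> the
          estimate fails; hence the case distinction.\<close>
        obtain m where m: "n = 4 + m" using False le_Suc_ex[of 4 n] by auto
        have "2 * (m + 6) \<le> (4 + m) * (3 + m)" by (simp add: algebra_simps)
        then show ?thesis by (simp add: m choose_two)
      qed
      finally show "card (\<Delta> ` nsets (S (n - 2)) 2) \<le> n choose 2" .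
    qed (rule n)
  qed
qed

section \<open>Assembling the cases\<close>

theorem theorem8:
  fixes \<Delta> :: "nat set \<Rightarrow> nat" and n :: nat
  assumes "infinite_colouring \<Delta>" and "n \<ge> 2"
  shows "\<exists>X. weakly_homogeneous \<Delta> n X"
proof (cases "\<exists>v. infinite (range (\<lambda>y. \<Delta> {v, y}))")
  case True
  then show ?thesis using weakly_homogeneous_infinite_degree[OF \<open>n \<ge> 2\<close>] by blast
next
  case False
  then have deg: "finite (range (\<lambda>y. \<Delta> {v, y}))" for v by blast
  obtain U :: "bool \<Rightarrow> nat \<Rightarrow> nat" where U: "\<And>i. U True i \<noteq> U False i"
    and matchU: "\<And>s i j y. j < i \<Longrightarrow> \<Delta> {U True i, U False i} \<noteq> \<Delta> {U s j, y}"
    using rainbow_matching[OF assms(1) deg] by blast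
  \<comment> \<open>If the vertices coincided, the later matching edge would be an edge at an
    earlier endpoint, with \<open>U (\<not> s) i\<close> as its other end.\<close>
  have neqU: "U s i \<noteq> U t j" if "j < i" for s t i j
    using matchU[OF that, of t "U (\<not> s) i"] by (cases s) (auto simp: insert_commute)
  have U_eq: "U s i = U t j \<longleftrightarrow> s = t \<and> i = j" for s t i j
    using neqU[of i j t s] neqU[of j i s t] U[of i]
    by (cases i j rule: linorder_cases) (cases s; cases t; auto)+
  \<comment> \<open>One function for each choice of ends, all four to be made canonical on a common
    \<open>H\<close>.\<close>
  define C where "C k i j = \<Delta> {U (fst k) i, U (snd k) j}" for k i j
  have "finite (range (C k i))" for k i
    using deg[of "U (fst k) i"] by (rule finite_subset[rotated]) (auto simp: C_def)
  then obtain H f where H: "infinite H" and can: "\<And>k. canonical_on H (C k) (f k)"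
    using ex_canonical_family[of UNIV C] by auto
  obtain r :: "nat \<Rightarrow> nat" where r: "strict_mono r" "\<And>i. r i \<in> H"
    using infinite_enumerate[OF H] by blast
  define V where "V s i = U s (r i)" for s i
  define F where "F k i = f k (r i)" for k i
  have V: "V s i = V t j \<longleftrightarrow> s = t \<and> i = j" for s t i j
    using U_eq strict_mono_eq[OF r(1)] by (simp add: V_def)
  have match: "\<Delta> {V True i, V False i} \<noteq> \<Delta> {V s j, y}" if "j < i" for s i j y
    using matchU that r(1) by (simp add: V_def strict_mono_less)
  have F: "\<Delta> {V s i, V t j} = F (s, t) i" if "i < j" for s t i j
    using can[of "(s, t)"] r that by (simp add: canonical_on_def C_def V_def F_def strict_mono_less)
  have F_alt: "inj (F k) \<or> (\<exists>c. \<forall>i. F k i = c)" for k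
    using can[of k] r strict_mono_eq[OF r(1)]
    unfolding canonical_on_def F_def inj_def inj_on_def by metis
  \<comment> \<open>If some \<open>F (s, t)\<close> is injective, then \<open>F (s, s)\<close> is
    either injective as well or constant.\<close>
  consider (same) s where "inj (F (s, s))"
    | (diff) s t c where "inj (F (s, t))" "\<And>i. F (s, s) i = c"
    | (const) "\<And>k. \<exists>c. \<forall>i. F k i = c"
    using F_alt by (metis surj_pair)
  then show ?thesis
  proof cases
    case same
    \<comment> \<open>The hub has index \<open>n\<close>, above all others used, so a spoke is
      coloured by its own index \<open>i\<close> and an earlier edge by its smaller index
      \<open>j < i\<close>; injectivity separates the two.\<close>
    show ?thesis
      by (rule weakly_homogeneous_hub[OF \<open>n \<ge> 2\<close>, of "V s" "V s n"])
        (use same in \<open>auto simp: V F inj_eq\<close>)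
  next
    case diff
    \<comment> \<open>The injective \<open>F (s, t)\<close> takes the colour \<open>c\<close> of the
      edges on side \<open>s\<close> at most once; the sequence starts beyond that index.\<close>
    obtain m where m: "\<And>i. i \<ge> m \<Longrightarrow> F (s, t) i \<noteq> c"
    proof (cases "\<exists>i. F (s, t) i = c")
      case True
      then obtain i where "F (s, t) i = c" by blast
      with diff(1) show thesis using that[of "Suc i"] by (metis Suc_n_not_le_n inj_eq)
    qed (use that in blast)
    show ?thesis
      by (rule weakly_homogeneous_hub[OF \<open>n \<ge> 2\<close>, of "\<lambda>i. V s (i + m)" "V t (n + m)"])
        (use diff m in \<open>auto simp: V F inj_eq\<close>)
  next
    case const
    then obtain c where "\<And>k i. F k i = c k" by metis
    then show ?thesis
      using F by (intro weakly_homogeneous_constant_matching[of n V \<Delta> c] \<open>n \<ge> 2\<close> V match) simp_all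
  qed
qed

end
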